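(* Given a positive nondecreasing sequence $0 < \sigma_1 \le \cdots \le \sigma_n$ and a nonzero starting vector $b \in \mathbb{R}^n$, there exists a matrix $A \in \mathbb{R}^{n \times n}$ such that the Arnoldi process for $A$ with starting vector $b$ satisfies $\|H_{k+1,k}\| = \sigma_k$ for $1 \le k \le n-1$, and $\|A\| = \sigma_n$.
   Context: $\|\cdot\|$ denotes the spectral norm for matrices and the Euclidean norm for vectors. Arnoldi process: let $v_1 = b/\|b\|$ and let $\mathcal{K}_k(A,v_1) = \mathrm{span}\{v_1, Av_1, \dots, A^{k-1}v_1\}$ be the Krylov space of order $k$. After $k$ steps the Krylov relation is $A V_k = V_{k+1} H_{k+1,k}$, where $V_k$ and $V_{k+1}$ are matrices with $k$ and $k+1$ orthonormal columns respectively (the first column being $v_1$, and $V_k$ consisting of the first $k$ columns of $V_{k+1}$), whose columns span $\mathcal{K}_k(A,v_1)$ and $\mathcal{K}_{k+1}(A,v_1)$ respectively, and $H_{k+1,k}$ is a $(k+1)\times k$ upper Hessenberg matrix. In particular $\|H_{k+1,k}\| = \|A V_k\|$. The existence of $H_{k+1,k}$ for all $1 \le k \le n-1$ (no breakdown of the process before that point, i.e. $\dim \mathcal{K}_{k+1}(A,v_1) = k+1$) is part of the assertion. *)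

theory Defs
  imports Complex_Main "Jordan_Normal_Form.VS_Connect"
begin

definition euclidean_norm :: "real vec \<Rightarrow> real" where
  "euclidean_norm x = sqrt (x \<bullet> x)"

(* The operator norm induced by the Euclidean norms. Taking the supremum over the closed unit
   ball rather than the unit sphere keeps the set nonempty when A has no columns. *)
definition spectral_norm :: "real mat \<Rightarrow> real" where
  "spectral_norm A =
     (SUP x \<in> {x \<in> carrier_vec (dim_col A). euclidean_norm x \<le> 1}. euclidean_norm (A *\<^sub>v x))"

(* With 0-based indices: everything strictly below the first subdiagonal vanishes. *)
definition upper_hessenberg :: "real mat \<Rightarrow> bool" where
  "upper_hessenberg H \<longleftrightarrow> (\<forall>i < dim_row H. \<forall>j < dim_col H. j + 1 < i \<longrightarrow> H $$ (i, j) = 0)"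

definition orthonormal_cols :: "real mat \<Rightarrow> bool" where
  "orthonormal_cols V \<longleftrightarrow>
     (\<forall>i < dim_col V. \<forall>j < dim_col V. col V i \<bullet> col V j = (if i = j then 1 else 0))"

definition real_span :: "nat \<Rightarrow> real vec set \<Rightarrow> real vec set" where
  "real_span n S = LinearCombinations.module.span class_ring (module_vec TYPE(real) n) S"

definition krylov_space :: "nat \<Rightarrow> real mat \<Rightarrow> real vec \<Rightarrow> nat \<Rightarrow> real vec set" where
  "krylov_space n A v k = real_span n {(A ^\<^sub>m j) *\<^sub>v v | j. j < k}"

(* The dimension of a linear subspace W of R^n, viewed as a vector space in its own right. *)
definition subspace_dim :: "nat \<Rightarrow> real vec set \<Rightarrow> nat" where
  "subspace_dim n W = vectorspace.dim class_ring (module_vec TYPE(real) n\<lparr>carrier := W\<rparr>)"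

(* V k and H k are the matrices V_k and H_{k+1,k} produced by m steps of the process without
   breakdown. The sign of each new basis vector is left free, so V and H are not unique. *)
definition arnoldi_process ::
  "nat \<Rightarrow> real mat \<Rightarrow> real vec \<Rightarrow> nat \<Rightarrow> (nat \<Rightarrow> real mat) \<Rightarrow> (nat \<Rightarrow> real mat) \<Rightarrow> bool" where
  "arnoldi_process n A b m V H \<longleftrightarrow>
     (let v1 = (1 / euclidean_norm b) \<cdot>\<^sub>v b in
       (\<forall>k \<in> {1..m+1}.
          V k \<in> carrier_mat n k \<and>
          orthonormal_cols (V k) \<and>
          col (V k) 0 = v1 \<and>
          real_span n (set (cols (V k))) = krylov_space n A v1 k) \<and>
       (\<forall>k \<in> {1..m}.
          (\<forall>j < k. col (V (k+1)) j = col (V k) j) \<and>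
          H k \<in> carrier_mat (k+1) k \<and>
          upper_hessenberg (H k) \<and>
          A * V k = V (k+1) * H k))"

end

theory Submission
  imports Defs "Jordan_Normal_Form.DL_Rank" "Jordan_Normal_Form.Schur_Decomposition"
begin

text \<open>Complete \<open>b / \<parallel>b\<parallel>\<close> to an orthonormal basis \<open>q\<^sub>1, \<dots>, q\<^sub>n\<close> and let \<open>A\<close> be the weighted cyclic
  shift \<open>A q\<^sub>j = \<sigma>\<^sub>j q\<^bsub>j+1\<^esub>\<close>, \<open>A q\<^sub>n = \<sigma>\<^sub>n q\<^sub>1\<close>. The \<open>k\<close>-th Krylov space is the span of
  \<open>q\<^sub>1, \<dots>, q\<^sub>k\<close>, and on it \<open>A\<close> is an isometry composed with the diagonal matrix with entries
  \<open>\<sigma>\<^sub>1 \<le> \<dots> \<le> \<sigma>\<^sub>k\<close>, hence has norm \<open>\<sigma>\<^sub>k\<close>. Indices are shifted down by one below.\<close>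

section \<open>Euclidean and spectral norms\<close>

lemma euclidean_norm_nonneg: "0 \<le> euclidean_norm x"
  by (simp add: euclidean_norm_def scalar_prod_def sum_nonneg)

lemma euclidean_norm_eq_0:
  assumes "x \<in> carrier_vec n"
  shows "euclidean_norm x = 0 \<longleftrightarrow> x = 0\<^sub>v n"
  using conjugate_square_eq_0_vec[OF assms] by (simp add: euclidean_norm_def)

lemma euclidean_norm_smult: "euclidean_norm (c \<cdot>\<^sub>v x) = \<bar>c\<bar> * euclidean_norm x"
  by (simp add: euclidean_norm_def real_sqrt_mult flip: mult.assoc)

lemma orthonormal_cols_gram:
  assumes "V \<in> carrier_mat n k" "orthonormal_cols V"
  shows "V\<^sup>T * V = 1\<^sub>m k"
  using assms by (auto simp: orthonormal_cols_def)

lemma orthonormal_cols_norm: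
  assumes V: "V \<in> carrier_mat n k" "orthonormal_cols V" and y: "y \<in> carrier_vec k"
  shows "euclidean_norm (V *\<^sub>v y) = euclidean_norm y"
proof -
  have "V\<^sup>T *\<^sub>v (V *\<^sub>v y) = y"
    using assoc_mult_mat_vec[of "V\<^sup>T" k n V k y] orthonormal_cols_gram[OF V] V y by simp
  moreover have "(V *\<^sub>v y) \<bullet> (V *\<^sub>v y) = (V\<^sup>T *\<^sub>v (V *\<^sub>v y)) \<bullet> y"
    using transpose_vec_mult_scalar[of V n k y "V *\<^sub>v y"] V y by simp
  ultimately show ?thesis by (simp add: euclidean_norm_def)
qed

text \<open>Attainment at a unit vector turns the supremum into a maximum, so boundedness of the set
  needs no separate argument.\<close>

lemma spectral_norm_eqI:
  assumes "\<And>x. x \<in> carrier_vec (dim_col A) \<Longrightarrow> euclidean_norm (A *\<^sub>v x) \<le> c * euclidean_norm x"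
    and "u \<in> carrier_vec (dim_col A)" "euclidean_norm u = 1" "euclidean_norm (A *\<^sub>v u) = c"
  shows "spectral_norm A = c"
  unfolding spectral_norm_def
proof (rule cSup_eq_maximum)
  have c: "0 \<le> c" using assms(4) euclidean_norm_nonneg by metis
  show "c \<in> (\<lambda>x. euclidean_norm (A *\<^sub>v x)) ` {x \<in> carrier_vec (dim_col A). euclidean_norm x \<le> 1}"
    using assms by force
  fix r assume "r \<in> (\<lambda>x. euclidean_norm (A *\<^sub>v x)) ` {x \<in> carrier_vec (dim_col A). euclidean_norm x \<le> 1}"
  then obtain x where x: "x \<in> carrier_vec (dim_col A)" "euclidean_norm x \<le> 1"
    "r = euclidean_norm (A *\<^sub>v x)" by auto
  then show "r \<le> c" using assms(1)[of x] mult_left_mono[of "euclidean_norm x" 1 c] c by simp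
qed

section \<open>Spans and dimension\<close>

lemma real_span_cols:
  assumes "V \<in> carrier_mat n k"
  shows "real_span n (set (cols V)) = {V *\<^sub>v y | y. y \<in> carrier_vec k}"
proof -
  interpret vec_space "TYPE(real)" n .
  show ?thesis
    using col_space_eq[OF assms] assms unfolding real_span_def col_space_def by auto
qed

text \<open>Being norm preserving, \<open>V\<close> has trivial kernel; hence its columns are
  independent and its rank is \<open>k\<close>. Applied to a Krylov space, this excludes
  breakdown.\<close>

lemma subspace_dim_orthonormal_cols:
  assumes V: "V \<in> carrier_mat n k" "orthonormal_cols V"
  shows "subspace_dim n (real_span n (set (cols V))) = k"
proof -
  interpret vec_space "TYPE(real)" n .
  have dist: "distinct (cols V)"
    using V unfolding distinct_conv_nth orthonormal_cols_def
    by (metis cols_length cols_nth zero_neq_one)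
  have "lin_indpt (set (cols V))"
  proof
    assume "lin_dep (set (cols V))"
    then obtain y where y: "y \<in> carrier_vec k" "y \<noteq> 0\<^sub>v k" "V *\<^sub>v y = 0\<^sub>v n"
      using lin_depE[OF V(1) _ dist] by blast
    then show False
      using orthonormal_cols_norm[OF V y(1)] by (metis euclidean_norm_eq_0 zero_carrier_vec)
  qed
  then show ?thesis
    using lin_indpt_full_rank[OF V(1) dist]
    by (simp add: rank_def subspace_dim_def real_span_def)
qed

text \<open>Used to replace the Krylov vectors, which are nonzero multiples of basis vectors, by the
  basis vectors themselves.\<close>

lemma real_span_smult_family:
  assumes "\<And>j. j < k \<Longrightarrow> q j \<in> carrier_vec n" and "\<And>j. j < k \<Longrightarrow> c j \<noteq> 0"
  shows "real_span n {c j \<cdot>\<^sub>v q j | j. j < k} = real_span n (q ` {..<k})"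
proof -
  interpret vec_space "TYPE(real)" n .
  let ?S = "{c j \<cdot>\<^sub>v q j | j. j < k}"
  have Q: "q ` {..<k} \<subseteq> carrier_vec n" and S: "?S \<subseteq> carrier_vec n"
    using assms by auto
  have "q j \<in> span ?S" if "j < k" for j
  proof -
    have "c j \<cdot>\<^sub>v q j \<in> span ?S" using that by (intro subsetD[OF in_own_span[OF S]]) auto
    from smult_in_span[OF S this, of "inverse (c j)"] show ?thesis
      using assms(2)[OF that] by (simp add: smult_smult_assoc)
  qed
  then have "q ` {..<k} \<subseteq> span ?S" by blast
  moreover have "c j \<cdot>\<^sub>v q j \<in> span (q ` {..<k})" if "j < k" for j
    using that by (intro smult_in_span[OF Q] subsetD[OF in_own_span[OF Q]]) auto
  then have "?S \<subseteq> span (q ` {..<k})" by clarify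
  ultimately show ?thesis
    unfolding real_span_def using span_subsetI[OF Q] span_subsetI[OF S] by (intro equalityI)
qed

section \<open>Matrices with prescribed columns\<close>

text \<open>One infinite sequence \<open>q\<close> serves every \<open>k\<close>, so that the frames
  are nested as the Arnoldi process demands of its bases.\<close>

definition frame :: "nat \<Rightarrow> (nat \<Rightarrow> real vec) \<Rightarrow> nat \<Rightarrow> real mat" where
  "frame n q k = mat_of_cols n (map q [0..<k])"

definition orthonormal_seq :: "nat \<Rightarrow> (nat \<Rightarrow> real vec) \<Rightarrow> nat \<Rightarrow> bool" where
  "orthonormal_seq n q k \<longleftrightarrow> (\<forall>i<k. q i \<in> carrier_vec n) \<and>
     (\<forall>i<k. \<forall>j<k. q i \<bullet> q j = (if i = j then 1 else 0))"

lemma frame_carrier [simp]: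
  "frame n q k \<in> carrier_mat n k" "dim_row (frame n q k) = n" "dim_col (frame n q k) = k"
  by (auto simp: frame_def)

lemma col_frame [simp]: "j < k \<Longrightarrow> q j \<in> carrier_vec n \<Longrightarrow> col (frame n q k) j = q j"
  by (simp add: frame_def)

lemma set_cols_frame:
  "(\<And>j. j < k \<Longrightarrow> q j \<in> carrier_vec n) \<Longrightarrow> set (cols (frame n q k)) = q ` {..<k}"
  unfolding frame_def by (subst cols_mat_of_cols) auto

lemma orthonormal_cols_frame: "orthonormal_seq n q k \<Longrightarrow> orthonormal_cols (frame n q k)"
  by (simp add: orthonormal_seq_def orthonormal_cols_def)

lemma orthonormal_seq_mono: "orthonormal_seq n q m \<Longrightarrow> k \<le> m \<Longrightarrow> orthonormal_seq n q k"
  by (simp add: orthonormal_seq_def)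

lemma mult_frame:
  assumes "A \<in> carrier_mat n n" "\<And>j. j < k \<Longrightarrow> q j \<in> carrier_vec n"
  shows "A * frame n q k = frame n (\<lambda>j. A *\<^sub>v q j) k"
proof (rule mat_col_eqI)
  fix j assume "j < dim_col (frame n (\<lambda>j. A *\<^sub>v q j) k)"
  then show "col (A * frame n q k) j = col (frame n (\<lambda>j. A *\<^sub>v q j) k) j"
    using assms col_mult2[of A n n "frame n q k" k j] by simp
qed (use assms in auto)

lemma frame_cong: "(\<And>j. j < k \<Longrightarrow> p j = q j) \<Longrightarrow> frame n p k = frame n q k"
  by (auto simp: frame_def intro: arg_cong[where f = "mat_of_cols n"])

text \<open>Scaling columns is right multiplication by a diagonal matrix, which is here moved onto
  the coordinate vector.\<close>

lemma frame_smult_mult_vec: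
  assumes "\<And>j. j < k \<Longrightarrow> p j \<in> carrier_vec n" "z \<in> carrier_vec k"
  shows "frame n (\<lambda>j. s j \<cdot>\<^sub>v p j) k *\<^sub>v z = frame n p k *\<^sub>v vec k (\<lambda>j. s j * z $ j)"
proof -
  have "(s j \<cdot>\<^sub>v p j) $ i = s j * p j $ i" if "i < n" "j < k" for i j
    using carrier_vecD[OF assms(1)[OF that(2)]] that by simp
  then show ?thesis
    using assms
    by (intro eq_vecI)
       (auto simp: frame_def scalar_prod_def mat_of_cols_index intro!: sum.cong)
qed

lemma euclidean_norm_scaled_le:
  assumes "z \<in> carrier_vec k" "\<And>j. j < k \<Longrightarrow> \<bar>s j\<bar> \<le> c"  "0 \<le> c"
  shows "euclidean_norm (vec k (\<lambda>j. s j * z $ j)) \<le> c * euclidean_norm z"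
proof -
  have "(\<Sum>j = 0..<k. (s j * z $ j) * (s j * z $ j)) \<le> (\<Sum>j = 0..<k. c\<^sup>2 * (z $ j * z $ j))"
  proof (rule sum_mono)
    fix j assume "j \<in> {0..<k}"
    then have "(s j)\<^sup>2 \<le> c\<^sup>2" using assms(2)[of j] abs_le_square_iff[of "s j" c] assms(3) by simp
    then have "(s j)\<^sup>2 * (z $ j * z $ j) \<le> c\<^sup>2 * (z $ j * z $ j)" by (simp add: mult_right_mono)
    then show "(s j * z $ j) * (s j * z $ j) \<le> c\<^sup>2 * (z $ j * z $ j)"
      by (simp add: power2_eq_square ac_simps)
  qed
  then have "sqrt (\<Sum>j = 0..<k. (s j * z $ j) * (s j * z $ j)) \<le> sqrt (c\<^sup>2 * (\<Sum>j = 0..<k. z $ j * z $ j))"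
    by (simp add: sum_distrib_left)
  then show ?thesis
    using assms by (simp add: euclidean_norm_def scalar_prod_def real_sqrt_mult)
qed

section \<open>Orthonormal basis and weighted cyclic shift\<close>

text \<open>Gram-Schmidt applied to a basis starting with \<open>v\<close> leaves its first vector
  unchanged.\<close>

lemma orthonormal_basis_extending:
  assumes v: "v \<in> carrier_vec n" "euclidean_norm v = 1"
  obtains q where "orthonormal_seq n q n" "q 0 = v"
proof -
  interpret cof_vec_space n "TYPE(real)" .
  have v0: "v \<noteq> 0\<^sub>v n" using v euclidean_norm_eq_0 by fastforce
  define B where "B = basis_completion v"
  define W where "W = gram_schmidt n B"
  note B = basis_completion[OF v(1) v0, folded B_def]
  note W = gram_schmidt_result[OF B(2) B(4) B(5) W_def]
  have n: "0 < n" using v v0 by (cases n) auto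
  then obtain B' where B': "B = v # B'" using B(6,7) by (cases B) auto
  have W0: "W ! 0 = v"
    using gram_schmidt_hd[OF v(1), of B'] W(4) B(6) n hd_conv_nth[of W] unfolding B' W_def by fastforce
  \<comment> \<open>\<open>W\<close> is only orthogonal. Normalizing does not move its head
    \<open>v\<close>, which already has norm 1.\<close>
  define q where "q i = (1 / euclidean_norm (W ! i)) \<cdot>\<^sub>v (W ! i)" for i
  have Wc: "W ! i \<in> carrier_vec n" if "i < n" for i using W(3,4) B(6) that by auto
  have ortho: "W ! i \<bullet> W ! j = 0 \<longleftrightarrow> i \<noteq> j" if "i < n" "j < n" for i j
    using corthogonalD[OF W(2)] W(4) B(6) that by simp
  have "orthonormal_seq n q n"
    unfolding orthonormal_seq_def
  proof (intro conjI allI impI)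
    fix i j assume ij: "i < n" "j < n"
    have "W ! i \<bullet> W ! i \<noteq> 0" "0 \<le> W ! i \<bullet> W ! i" using ortho ij
      by (auto simp: scalar_prod_def intro: sum_nonneg)
    then show "q i \<bullet> q j = (if i = j then 1 else 0)"
      using ortho[OF ij] Wc[OF ij(1)] Wc[OF ij(2)] by (auto simp: q_def euclidean_norm_def)
  qed (use Wc in \<open>auto simp: q_def\<close>)
  moreover have "q 0 = v" using v by (simp add: q_def W0)
  ultimately show thesis using that by blast
qed

text \<open>The transpose of \<open>?Q\<close> sends \<open>q j\<close> to the j-th unit vector,
  which \<open>?P\<close> sends to the desired image. The reduction mod \<open>n\<close> closes the
  cycle.\<close>

lemma weighted_shift_exists:
  assumes q: "orthonormal_seq n q n"
  obtains A where "A \<in> carrier_mat n n" "\<And>j. j < n \<Longrightarrow> A *\<^sub>v q j = s j \<cdot>\<^sub>v q (Suc j mod n)"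
proof
  let ?Q = "frame n q n"
  let ?P = "frame n (\<lambda>j. s j \<cdot>\<^sub>v q (Suc j mod n)) n"
  show A: "?P * ?Q\<^sup>T \<in> carrier_mat n n" by (rule mult_carrier_mat) auto
  have "(?P * ?Q\<^sup>T) * ?Q = ?P"
    using assoc_mult_mat[of ?P n n "?Q\<^sup>T" n ?Q n] orthonormal_cols_gram[of ?Q n n]
      orthonormal_cols_frame[OF q] right_mult_one_mat[of ?P n n] by simp
  moreover fix j assume j: "j < n"
  moreover have "q j \<in> carrier_vec n" "q (Suc j mod n) \<in> carrier_vec n"
    using q j by (auto simp: orthonormal_seq_def)
  ultimately show "(?P * ?Q\<^sup>T) *\<^sub>v q j = s j \<cdot>\<^sub>v q (Suc j mod n)"
    using col_mult2[OF A frame_carrier(1) j, of q] by simp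
qed

text \<open>On the first \<open>k\<close> basis vectors, \<open>A\<close> scales the coordinates by
  \<open>s\<close> and then applies the isometry \<open>frame n p k\<close>. The case
  \<open>k = n\<close> is included, so the bound serves both the Hessenberg matrices and
  \<open>A\<close> itself.\<close>

lemma weighted_shift_norm_le:
  assumes q: "orthonormal_seq n q n" and A: "A \<in> carrier_mat n n"
    and Aq: "\<And>j. j < n \<Longrightarrow> A *\<^sub>v q j = s j \<cdot>\<^sub>v q (Suc j mod n)"
    and k: "k \<le> n" and c: "\<And>j. j < k \<Longrightarrow> \<bar>s j\<bar> \<le> c" "0 \<le> c" and z: "z \<in> carrier_vec k"
  shows "euclidean_norm (A *\<^sub>v (frame n q k *\<^sub>v z)) \<le> c * euclidean_norm z"
proof -
  define p where "p j = q (Suc j mod n)" for j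
  \<comment> \<open>The cyclic shift permutes the indices below \<open>n\<close>, so the images
    \<open>p j\<close> are again distinct members of the basis.\<close>
  have inj: "Suc i mod n = Suc j mod n \<longleftrightarrow> i = j" if "i < n" "j < n" for i j
    using that by (auto simp: mod_Suc)
  have p: "orthonormal_seq n p k"
    using q k inj by (auto simp: orthonormal_seq_def p_def)
  have "A *\<^sub>v (frame n q k *\<^sub>v z) = (A * frame n q k) *\<^sub>v z"
    by (rule assoc_mult_mat_vec[symmetric, OF A frame_carrier(1) z])
  also have "A * frame n q k = frame n (\<lambda>j. A *\<^sub>v q j) k"
    using q k by (intro mult_frame A) (auto simp: orthonormal_seq_def)
  also have "\<dots> = frame n (\<lambda>j. s j \<cdot>\<^sub>v p j) k"
    using Aq k by (intro frame_cong) (simp add: p_def)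
  also have "\<dots> *\<^sub>v z = frame n p k *\<^sub>v vec k (\<lambda>j. s j * z $ j)"
    using p z by (intro frame_smult_mult_vec) (auto simp: orthonormal_seq_def)
  finally show ?thesis
    using orthonormal_cols_norm[OF frame_carrier(1) orthonormal_cols_frame[OF p]]
      euclidean_norm_scaled_le[OF z c] by simp
qed

text \<open>The scalar is a product of weights; \<open>i + j < n\<close> means that the walk never
  wraps around. A matrix power splits off its factor on the right, so the first step goes from
  \<open>q i\<close> to \<open>q (Suc i)\<close> and the induction must generalize
  \<open>i\<close>.\<close>

lemma weighted_shift_power:
  assumes q: "orthonormal_seq n q n" and A: "A \<in> carrier_mat n n"
    and Aq: "\<And>j. j < n \<Longrightarrow> A *\<^sub>v q j = s j \<cdot>\<^sub>v q (Suc j mod n)"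
    and s: "\<And>j. j < n \<Longrightarrow> s j \<noteq> 0"
  shows "i + j < n \<Longrightarrow> \<exists>c. c \<noteq> 0 \<and> (A ^\<^sub>m j) *\<^sub>v q i = c \<cdot>\<^sub>v q (i + j)"
proof (induction j arbitrary: i)
  case 0
  then have "q i \<in> carrier_vec n" using q by (simp add: orthonormal_seq_def)
  then show ?case using A by (intro exI[of _ 1]) auto
next
  case (Suc j)
  then obtain c where c: "c \<noteq> 0" "(A ^\<^sub>m j) *\<^sub>v q (Suc i) = c \<cdot>\<^sub>v q (Suc i + j)"
    by (metis add_Suc_shift)
  have qc: "q i \<in> carrier_vec n" "q (Suc i) \<in> carrier_vec n"
    using q Suc.prems by (auto simp: orthonormal_seq_def)
  have Aj: "A ^\<^sub>m j \<in> carrier_mat n n" using A by simp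
  have "(A ^\<^sub>m Suc j) *\<^sub>v q i = (A ^\<^sub>m j) *\<^sub>v (s i \<cdot>\<^sub>v q (Suc i))"
    using assoc_mult_mat_vec[OF Aj A qc(1)] Aq[of i] Suc.prems by simp
  also have "\<dots> = (s i * c) \<cdot>\<^sub>v q (i + Suc j)"
    using mult_mat_vec[OF Aj qc(2)] c by (simp add: smult_smult_assoc)
  finally show ?case using c(1) s[of i] Suc.prems by (intro exI[of _ "s i * c"]) simp
qed

lemma weighted_shift_krylov:
  assumes q: "orthonormal_seq n q n" and A: "A \<in> carrier_mat n n"
    and Aq: "\<And>j. j < n \<Longrightarrow> A *\<^sub>v q j = s j \<cdot>\<^sub>v q (Suc j mod n)"
    and s: "\<And>j. j < n \<Longrightarrow> s j \<noteq> 0" and k: "k \<le> n"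
  shows "krylov_space n A (q 0) k = real_span n (set (cols (frame n q k)))"
proof -
  have "\<exists>c. c \<noteq> 0 \<and> (A ^\<^sub>m j) *\<^sub>v q 0 = c \<cdot>\<^sub>v q j" if "j < k" for j
    using weighted_shift_power[OF q A Aq s, of 0 j] that k by simp
  then obtain c where c: "c j \<noteq> 0" "(A ^\<^sub>m j) *\<^sub>v q 0 = c j \<cdot>\<^sub>v q j" if "j < k" for j
    by metis
  have qc: "q j \<in> carrier_vec n" if "j < k" for j using q that k by (simp add: orthonormal_seq_def)
  have "{(A ^\<^sub>m j) *\<^sub>v q 0 | j. j < k} = {c j \<cdot>\<^sub>v q j | j. j < k}" using c(2) by metis
  then show ?thesis
    using real_span_smult_family[of k q n c] qc c(1) by (simp add: krylov_space_def set_cols_frame)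
qed

section \<open>The Arnoldi process of the shift and its norms\<close>

text \<open>In the basis \<open>q\<close> the Hessenberg matrix carries the weights on its
  subdiagonal and zeros elsewhere.\<close>

lemma weighted_shift_arnoldi:
  assumes q: "orthonormal_seq n q n" and q0: "q 0 = (1 / euclidean_norm b) \<cdot>\<^sub>v b"
    and A: "A \<in> carrier_mat n n"
    and Aq: "\<And>j. j < n \<Longrightarrow> A *\<^sub>v q j = s j \<cdot>\<^sub>v q (Suc j mod n)"
    and s: "\<And>j. j < n \<Longrightarrow> s j \<noteq> 0" and n: "0 < n"
  shows "arnoldi_process n A b (n - 1) (frame n q)
           (\<lambda>k. mat (k + 1) k (\<lambda>(i, j). if i = j + 1 then s j else 0))"
    (is "arnoldi_process n A b (n - 1) _ ?H")
proof -
  have qc: "q j \<in> carrier_vec n" if "j < n" for j using q that by (simp add: orthonormal_seq_def)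
  \<comment> \<open>For \<open>j < k < n\<close> the successor index \<open>j + 1\<close> stays
    below \<open>n\<close>, so the wrap-around column is never met.\<close>
  have rel: "A * frame n q k = frame n q (k + 1) * ?H k" if k: "k < n" for k
  proof (rule mat_col_eqI)
    fix j assume "j < dim_col (frame n q (k + 1) * ?H k)"
    then have j: "j < k" by simp
    have colH: "col (?H k) j = vec (k + 1) (\<lambda>i. if i = j + 1 then s j else 0)"
      using j by (intro eq_vecI) auto
    have "col (A * frame n q k) j = s j \<cdot>\<^sub>v q (j + 1)"
      using col_mult2[OF A frame_carrier(1) j, of q] Aq[of j] qc[of j] j k by simp
    also have "\<dots> = frame n q (k + 1) *\<^sub>v col (?H k) j"
      using qc[of "j + 1"] j k unfolding colH
      by (intro eq_vecI)
         (auto simp: frame_def scalar_prod_def mat_of_cols_index if_distrib[of "\<lambda>x. _ * x"] nth_append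
           simp del: upt_Suc cong: if_cong)
    also have "\<dots> = col (frame n q (k + 1) * ?H k) j"
      using j by (intro col_mult2[symmetric, of _ n "k + 1" _ k]) auto
    finally show "col (A * frame n q k) j = col (frame n q (k + 1) * ?H k) j" .
  qed (use A in auto)
  show ?thesis
    unfolding arnoldi_process_def Let_def
  proof (intro conjI ballI allI impI)
    fix k assume "k \<in> {1..n - 1 + 1}"
    then have k: "0 < k" "k \<le> n" using n by auto
    show "orthonormal_cols (frame n q k)"
      using orthonormal_cols_frame orthonormal_seq_mono q k by blast
    show "col (frame n q k) 0 = (1 / euclidean_norm b) \<cdot>\<^sub>v b"
      using k qc[of 0] by (simp add: q0)
    show "real_span n (set (cols (frame n q k))) = krylov_space n A ((1 / euclidean_norm b) \<cdot>\<^sub>v b) k"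
      using weighted_shift_krylov[OF q A Aq s k(2)] by (simp add: q0)
  next
    fix k assume "k \<in> {1..n - 1}"
    then have k: "k < n" by auto
    show "A * frame n q k = frame n q (k + 1) * ?H k" by (rule rel[OF k])
    show "col (frame n q (k + 1)) j = col (frame n q k) j" if "j < k" for j
      using that k qc by simp
    show "upper_hessenberg (?H k)" by (auto simp: upper_hessenberg_def)
  qed auto
qed

text \<open>\<open>\<parallel>H\<^sub>k\<parallel>\<close> is the norm of \<open>A\<close> restricted to the Krylov space, so it does not depend on
  the choice of \<open>V\<close> and \<open>H\<close>.\<close>

lemma weighted_shift_spectral_norm_hessenberg:
  assumes q: "orthonormal_seq n q n" and q0: "q 0 = (1 / euclidean_norm b) \<cdot>\<^sub>v b"
    and A: "A \<in> carrier_mat n n"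
    and Aq: "\<And>j. j < n \<Longrightarrow> A *\<^sub>v q j = s j \<cdot>\<^sub>v q (Suc j mod n)"
    and pos: "\<And>j. j < n \<Longrightarrow> 0 < s j" and mono: "\<And>i j. i \<le> j \<Longrightarrow> j < n \<Longrightarrow> s i \<le> s j"
    and arn: "arnoldi_process n A b (n - 1) V H" and k: "k \<in> {1..n - 1}"
  shows "spectral_norm (H k) = s (k - 1)"
proof -
  have kn: "0 < k" "k < n" "k \<le> n" "k - 1 < n" using k by auto
  let ?Q = "frame n q k"
  have V: "V k \<in> carrier_mat n k" "orthonormal_cols (V k)"
    and V': "V (k + 1) \<in> carrier_mat n (k + 1)" "orthonormal_cols (V (k + 1))"
    and spanV: "real_span n (set (cols (V k))) = krylov_space n A (q 0) k"
    and H: "H k \<in> carrier_mat (k + 1) k" and rel: "A * V k = V (k + 1) * H k"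
    using arn k by (auto simp: arnoldi_process_def Let_def q0)
  have Q: "orthonormal_cols ?Q"
    using orthonormal_cols_frame orthonormal_seq_mono q kn(3) by blast
  have nz: "\<And>j. j < n \<Longrightarrow> s j \<noteq> 0" using pos by fastforce
  \<comment> \<open>Both matrices span the same Krylov space. This lets vectors pass between the
    arbitrary basis \<open>V k\<close> and the known basis \<open>q\<close>.\<close>
  have range: "{V k *\<^sub>v y | y. y \<in> carrier_vec k} = {?Q *\<^sub>v z | z. z \<in> carrier_vec k}"
    using spanV weighted_shift_krylov[OF q A Aq nz kn(3)] real_span_cols[OF V(1)]
      real_span_cols[OF frame_carrier(1)] by simp
  have normH: "euclidean_norm (H k *\<^sub>v y) = euclidean_norm (A *\<^sub>v (V k *\<^sub>v y))"
    if y: "y \<in> carrier_vec k" for y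
  proof -
    have "A *\<^sub>v (V k *\<^sub>v y) = V (k + 1) *\<^sub>v (H k *\<^sub>v y)"
      using assoc_mult_mat_vec[OF A V(1) y] assoc_mult_mat_vec[OF V'(1) H y] rel by simp
    then show ?thesis using orthonormal_cols_norm[OF V', of "H k *\<^sub>v y"] H y by simp
  qed
  \<comment> \<open>The last basis vector of the Krylov space carries its largest weight; its
    coordinates \<open>u\<close> with respect to \<open>V k\<close> are where the norm is
    attained.\<close>
  have qk: "q (k - 1) = ?Q *\<^sub>v unit_vec k (k - 1)"
    using kn q by (intro eq_vecI) (auto simp: orthonormal_seq_def frame_def mat_of_cols_index)
  then obtain u where u: "u \<in> carrier_vec k" "V k *\<^sub>v u = q (k - 1)"
    using range by (smt (verit) mem_Collect_eq unit_vec_carrier)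
  have norm_q: "euclidean_norm (q j) = 1" if "j < n" for j
    using q that by (simp add: euclidean_norm_def orthonormal_seq_def)
  show ?thesis
  proof (rule spectral_norm_eqI)
    show "u \<in> carrier_vec (dim_col (H k))" using u H by simp
    show "euclidean_norm u = 1"
      using orthonormal_cols_norm[OF V u(1)] norm_q[of "k - 1"] u(2) kn by simp
    show "euclidean_norm (H k *\<^sub>v u) = s (k - 1)"
      using normH[OF u(1)] u(2) Aq[OF kn(4)] kn norm_q[of k] pos[OF kn(4)]
      by (simp add: euclidean_norm_smult)
  next
    fix y :: "real vec" assume "y \<in> carrier_vec (dim_col (H k))"
    then have y: "y \<in> carrier_vec k" using H by simp
    then obtain z where z: "z \<in> carrier_vec k" "V k *\<^sub>v y = ?Q *\<^sub>v z"
      using range by (smt (verit) mem_Collect_eq)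
    \<comment> \<open>\<open>y\<close> and \<open>z\<close> are coordinates of one vector in two
      orthonormal bases.\<close>
    have "euclidean_norm z = euclidean_norm y"
      using orthonormal_cols_norm[OF V y] orthonormal_cols_norm[OF frame_carrier(1) Q z(1)] z(2) by simp
    moreover have "\<bar>s j\<bar> \<le> s (k - 1)" if "j < k" for j
      using pos[of j] mono[of j "k - 1"] that kn by simp
    ultimately show "euclidean_norm (H k *\<^sub>v y) \<le> s (k - 1) * euclidean_norm y"
      using weighted_shift_norm_le[OF q A Aq kn(3) _ _ z(1), of "s (k - 1)"] normH[OF y] z(2)
        pos[of "k - 1"] kn by simp
  qed
qed

lemma weighted_shift_spectral_norm:
  assumes q: "orthonormal_seq n q n" and A: "A \<in> carrier_mat n n"
    and Aq: "\<And>j. j < n \<Longrightarrow> A *\<^sub>v q j = s j \<cdot>\<^sub>v q (Suc j mod n)"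
    and pos: "\<And>j. j < n \<Longrightarrow> 0 < s j" and mono: "\<And>i j. i \<le> j \<Longrightarrow> j < n \<Longrightarrow> s i \<le> s j"
    and n: "0 < n"
  shows "spectral_norm A = s (n - 1)"
proof (rule spectral_norm_eqI)
  let ?Q = "frame n q n"
  have norm_q: "euclidean_norm (q j) = 1" if "j < n" for j
    using q that by (simp add: euclidean_norm_def orthonormal_seq_def)
  show "q (n - 1) \<in> carrier_vec (dim_col A)" using q A n by (simp add: orthonormal_seq_def)
  show "euclidean_norm (q (n - 1)) = 1" using norm_q n by simp
  \<comment> \<open>The maximum is attained at the vector that wraps around to
    \<open>q 0\<close>.\<close>
  show "euclidean_norm (A *\<^sub>v q (n - 1)) = s (n - 1)"
    using Aq[of "n - 1"] n norm_q[of 0] pos[of "n - 1"] by (simp add: euclidean_norm_smult)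
  fix x :: "real vec" assume "x \<in> carrier_vec (dim_col A)"
  then have x: "x \<in> carrier_vec n" using A by simp
  have Q: "orthonormal_cols ?Q" by (rule orthonormal_cols_frame[OF q])
  have Qt: "?Q\<^sup>T \<in> carrier_mat n n" by simp
  define z where "z = ?Q\<^sup>T *\<^sub>v x"
  have z: "z \<in> carrier_vec n" unfolding z_def by (rule mult_mat_vec_carrier[OF Qt x])
  \<comment> \<open>For a square matrix a left inverse is a right inverse, so every \<open>x\<close>
    has coordinates in the basis \<open>q\<close>.\<close>
  have "?Q * ?Q\<^sup>T = 1\<^sub>m n"
    using mat_mult_left_right_inverse[OF Qt frame_carrier(1)] orthonormal_cols_gram[OF frame_carrier(1) Q]
    by simp
  then have xz: "x = ?Q *\<^sub>v z"
    unfolding z_def using assoc_mult_mat_vec[of ?Q n n "?Q\<^sup>T" n x] Qt x by simp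
  have "\<bar>s j\<bar> \<le> s (n - 1)" if "j < n" for j
    using pos[of j] mono[of j "n - 1"] that by simp
  then show "euclidean_norm (A *\<^sub>v x) \<le> s (n - 1) * euclidean_norm x"
    using weighted_shift_norm_le[OF q A Aq order_refl _ _ z, of "s (n - 1)"] xz
      orthonormal_cols_norm[OF frame_carrier(1) Q z] pos[of "n - 1"] n by simp
qed

theorem proposition4p1:
  fixes n :: nat and \<sigma> :: "nat \<Rightarrow> real" and b :: "real vec"
  assumes "0 < \<sigma> 1"
    and "\<forall>k. 1 \<le> k \<and> k < n \<longrightarrow> \<sigma> k \<le> \<sigma> (k + 1)"
    and "b \<in> carrier_vec n"
    and "b \<noteq> 0\<^sub>v n"
  shows "\<exists>A \<in> carrier_mat n n.
           (\<forall>k \<in> {1..n-1}.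
              subspace_dim n (krylov_space n A ((1 / euclidean_norm b) \<cdot>\<^sub>v b) (k + 1)) = k + 1) \<and>
           (\<exists>V H. arnoldi_process n A b (n - 1) V H) \<and>
           (\<forall>V H. arnoldi_process n A b (n - 1) V H \<longrightarrow>
              (\<forall>k \<in> {1..n-1}. spectral_norm (H k) = \<sigma> k)) \<and>
           spectral_norm A = \<sigma> n"
proof -
  \<comment> \<open>The weights are indexed from 0, the given sequence from 1.\<close>
  define s where "s j = \<sigma> (Suc j)" for j
  \<comment> \<open>In dimension 0 the only vector is zero, which \<open>b\<close> is not.\<close>
  have n: "0 < n" using assms(3,4) by (cases n) auto
  have mono: "s i \<le> s j" if "i \<le> j" "j < n" for i j
    using that
  proof (induction j rule: dec_induct)
    case (step m)
    then show ?case using assms(2) by (auto simp: s_def intro: order_trans[of _ "\<sigma> (Suc m)"])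
  qed simp
  have pos: "0 < s j" if "j < n" for j
    using mono[of 0 j] that assms(1) by (simp add: s_def)
  have nz: "s j \<noteq> 0" if "j < n" for j using pos that by fastforce
  let ?v = "(1 / euclidean_norm b) \<cdot>\<^sub>v b"
  have "euclidean_norm ?v = 1"
    using euclidean_norm_eq_0[OF assms(3)] assms(4) euclidean_norm_nonneg[of b]
    by (simp add: euclidean_norm_smult)
  then obtain q where q: "orthonormal_seq n q n" and q0: "q 0 = ?v"
    using orthonormal_basis_extending[of ?v n] assms(3) by auto
  obtain A where A: "A \<in> carrier_mat n n"
    and Aq: "\<And>j. j < n \<Longrightarrow> A *\<^sub>v q j = s j \<cdot>\<^sub>v q (Suc j mod n)"
    using weighted_shift_exists[OF q, of s] by blast
  show ?thesis
  proof (intro bexI[OF _ A] conjI ballI allI impI)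
    fix k assume "k \<in> {1..n - 1}"
    then have k: "k + 1 \<le> n" by auto
    show "subspace_dim n (krylov_space n A ?v (k + 1)) = k + 1"
      using weighted_shift_krylov[OF q A Aq nz k] q0
        subspace_dim_orthonormal_cols[OF frame_carrier(1)
          orthonormal_cols_frame[OF orthonormal_seq_mono[OF q k]]] by simp
  next
    show "\<exists>V H. arnoldi_process n A b (n - 1) V H"
      using weighted_shift_arnoldi[OF q q0 A Aq nz n] by blast
  next
    fix V H k assume "arnoldi_process n A b (n - 1) V H" "k \<in> {1..n - 1}"
    then show "spectral_norm (H k) = \<sigma> k"
      using weighted_shift_spectral_norm_hessenberg[OF q q0 A Aq pos mono, of V H k]
      by (simp add: s_def)
  next
    show "spectral_norm A = \<sigma> n"
      using weighted_shift_spectral_norm[OF q A Aq pos mono n] n by (simp add: s_def)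
  qed
qed

end
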